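(* There are absolute constants $c, C > 0$ such that, for every pair of integers $a, k \ge 2$, $$ c\left(a+k+\frac{ak}{\log(k+2)}\right) \le f(a,k) \le C\left(a+k+\frac{ak}{\log(k+2)}\right). $$
   Context: All graphs are finite and simple. $\delta(G)$ denotes the minimum degree of a graph $G$, and $\log$ is the natural logarithm. Given positive integers $s,t$, an $(s,t)$-bipartite hole in a graph $G$ is a pair of disjoint vertex sets $S,T \subseteq V(G)$ with $|S|=s$, $|T|=t$, and no edge of $G$ between $S$ and $T$. The bipartite-hole-number $\widetilde{\alpha}(G)$ is the least integer $r$ that can be written as $r=s+t-1$ for some positive integers $s,t$ such that $G$ contains no $(s,t)$-bipartite hole. For integers $a,k\ge 2$, $f(a,k)$ is the least integer $d$ such that every graph $G$ on at least three vertices with $\widetilde{\alpha}(G)\le a$ and $\delta(G)\ge d$ contains $k$ pairwise edge-disjoint Hamilton cycles. *)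

theory Defs
  imports Complex_Main "HOL-Library.Disjoint_Sets"
begin

text \<open>A graph is given by a vertex set \<open>V\<close> and a set \<open>E\<close> of edges, each edge being a
  two-element subset of \<open>V\<close>.\<close>

definition simple_graph :: "'a set \<Rightarrow> 'a set set \<Rightarrow> bool" where
  "simple_graph V E \<longleftrightarrow> finite V \<and> (\<forall>e\<in>E. e \<subseteq> V \<and> card e = 2)"

definition degree :: "'a set set \<Rightarrow> 'a \<Rightarrow> nat" where
  "degree E v = card {e \<in> E. v \<in> e}"

text \<open>Only meaningful for finite nonempty \<open>V\<close>.\<close>

definition min_degree :: "'a set \<Rightarrow> 'a set set \<Rightarrow> nat" where
  "min_degree V E = Min (degree E ` V)"

definition has_bipartite_hole :: "'a set \<Rightarrow> 'a set set \<Rightarrow> nat \<Rightarrow> nat \<Rightarrow> bool" where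
  "has_bipartite_hole V E s t \<longleftrightarrow>
     (\<exists>S T. S \<subseteq> V \<and> T \<subseteq> V \<and> S \<inter> T = {} \<and> card S = s \<and> card T = t \<and>
        (\<forall>x\<in>S. \<forall>y\<in>T. {x, y} \<notin> E))"

text \<open>For finite \<open>V\<close> the minimum is taken over a nonempty set, since there is no
  \<open>(s,t)\<close>-hole once \<open>s + t\<close> exceeds the number of vertices.\<close>

definition bipartite_hole_number :: "'a set \<Rightarrow> 'a set set \<Rightarrow> nat" where
  "bipartite_hole_number V E =
     (LEAST r. \<exists>s t. s \<ge> 1 \<and> t \<ge> 1 \<and> r = s + t - 1 \<and> \<not> has_bipartite_hole V E s t)"

text \<open>The list \<open>[x\<^sub>0, \<dots>, x\<^sub>n]\<close> denotes the closed walk \<open>x\<^sub>0, \<dots>, x\<^sub>n, x\<^sub>0\<close>.\<close>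

definition cycle_edges :: "'a list \<Rightarrow> 'a set set" where
  "cycle_edges xs = {{xs ! i, xs ! (Suc i mod length xs)} | i. i < length xs}"

definition hamilton_cycle :: "'a set \<Rightarrow> 'a set set \<Rightarrow> 'a list \<Rightarrow> bool" where
  "hamilton_cycle V E xs \<longleftrightarrow>
     length xs \<ge> 3 \<and> distinct xs \<and> set xs = V \<and> cycle_edges xs \<subseteq> E"

definition has_disjoint_hamilton_cycles :: "'a set \<Rightarrow> 'a set set \<Rightarrow> nat \<Rightarrow> bool" where
  "has_disjoint_hamilton_cycles V E k \<longleftrightarrow>
     (\<exists>H :: nat \<Rightarrow> 'a list. (\<forall>i<k. hamilton_cycle V E (H i)) \<and>
        disjoint_family_on (\<lambda>i. cycle_edges (H i)) {..<k})"

text \<open>Vertices are natural numbers, which represents every finite graph up to isomorphism.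
  Minimising over \<open>nat\<close> agrees with minimising over the integers, because minimum degrees
  are nonnegative and \<open>d = 0\<close> never has the property for \<open>a, k \<ge> 2\<close> (consider the path on
  three vertices).\<close>

definition forces_hamilton_cycles :: "nat \<Rightarrow> nat \<Rightarrow> nat \<Rightarrow> bool" where
  "forces_hamilton_cycles a k d \<longleftrightarrow>
     (\<forall>(V :: nat set) E. simple_graph V E \<longrightarrow> card V \<ge> 3 \<longrightarrow>
        bipartite_hole_number V E \<le> a \<longrightarrow> min_degree V E \<ge> d \<longrightarrow>
        has_disjoint_hamilton_cycles V E k)"

definition hamilton_threshold :: "nat \<Rightarrow> nat \<Rightarrow> nat" where
  "hamilton_threshold a k = (LEAST d. forces_hamilton_cycles a k d)"

end

theory Submission
  imports Defs
begin

text \<open>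
  The proof of the upper bound removes Hamilton cycles one after another. A graph without an
  \<open>(s, t)\<close>-hole in which every vertex has degree at least \<open>s + t - 1\<close> is Hamiltonian
  (\<open>hamilton_cycle_if_no_hole\<close>), so it is enough to control the holes that appear when a graph
  \<open>R\<close> of maximum degree at most \<open>2 * k\<close>, the union of the cycles found so far, is deleted.
  Between the two parts \<open>S\<close> and \<open>T\<close> of such a new hole, all old edges belong to \<open>R\<close>, hence
  they are few. But the absence of old holes says that each \<open>s\<close>-subset of \<open>S\<close> dominates all but
  \<open>t\<close> vertices of \<open>T\<close>. Taking \<open>S\<close> of size \<open>3 * s\<close> and averaging over its \<open>s\<close>-subsets
  shows that a typical vertex of \<open>T\<close> needs about \<open>log (card T / t)\<close> old neighbours in \<open>S\<close>,
  rather than one. This is where the logarithm is gained: the size of \<open>T\<close> is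
  \<open>O(k + t * k / log k)\<close> (\<open>no_hole_after_sparse_removal\<close>), and so a minimum degree of this
  order plus \<open>O(a + k)\<close> lets the removal continue for \<open>k\<close> rounds.

  The lower bound comes from one construction: join a clique on \<open>m\<close> vertices completely to a
  graph \<open>H\<close> on \<open>n > m\<close> vertices. Its minimum degree is at least \<open>m\<close>, its holes are those of
  \<open>H\<close>, and each Hamilton cycle uses at least \<open>n - m\<close> edges of \<open>H\<close>; so fewer than
  \<open>k * (n - m)\<close> edges in \<open>H\<close> rule out \<open>k\<close> disjoint Hamilton cycles
  (\<open>forces_hamilton_cycles_clique_join\<close>). A complete \<open>H\<close> gives the term \<open>k\<close>, an empty
  \<open>H\<close> the term \<open>a\<close>, and a sparse \<open>H\<close> on about \<open>a * k / log k\<close> vertices without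
  \<open>(a div 2, a div 2)\<close>-holes, found by a greedy hitting set argument, gives the main term.
\<close>

section \<open>Neighbourhoods and holes\<close>

definition neighbours :: "'a set set \<Rightarrow> 'a \<Rightarrow> 'a set" where
  "neighbours E v = {w. {v, w} \<in> E}"

lemma edge_in_simple_graph:
  assumes "simple_graph V E" "{x, y} \<in> E"
  shows "x \<in> V" "y \<in> V" "x \<noteq> y"
proof -
  have "{x, y} \<subseteq> V" "card {x, y} = 2"
    using assms unfolding simple_graph_def by blast+
  then show "x \<in> V" "y \<in> V" "x \<noteq> y" by (auto simp: card_insert_if split: if_splits)
qed

lemma neighbours_subset:
  assumes "simple_graph V E"
  shows "neighbours E v \<subseteq> V - {v}"
  using edge_in_simple_graph[OF assms] unfolding neighbours_def by blast

lemma finite_neighbours: "simple_graph V E \<Longrightarrow> finite (neighbours E v)"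
  by (meson finite_Diff finite_subset neighbours_subset simple_graph_def)

lemma degree_eq_card_neighbours:
  assumes "simple_graph V E"
  shows "degree E v = card (neighbours E v)"
proof -
  have "bij_betw (\<lambda>w. {v, w}) (neighbours E v) {e \<in> E. v \<in> e}"
  proof (rule bij_betw_imageI)
    show "inj_on (\<lambda>w. {v, w}) (neighbours E v)"
      by (auto simp: inj_on_def doubleton_eq_iff)
    have "e \<in> (\<lambda>w. {v, w}) ` neighbours E v" if e: "e \<in> E" "v \<in> e" for e
    proof -
      have "card e = 2" using assms e unfolding simple_graph_def by blast
      then obtain w where "e = {v, w}"
        using e by (auto simp: card_2_iff)
      then show ?thesis using e by (auto simp: neighbours_def)
    qed
    then show "(\<lambda>w. {v, w}) ` neighbours E v = {e \<in> E. v \<in> e}"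
      by (auto simp: neighbours_def)
  qed
  then show ?thesis unfolding degree_def by (simp add: bij_betw_same_card)
qed

text \<open>A hole is required to have parts of exact sizes; shrinking the parts keeps it a hole, so
  lower bounds on the sizes are enough.\<close>

lemma has_bipartite_holeI:
  assumes "S \<subseteq> V" "T \<subseteq> V" "S \<inter> T = {}" "s \<le> card S" "t \<le> card T"
    and "\<And>x y. x \<in> S \<Longrightarrow> y \<in> T \<Longrightarrow> {x, y} \<notin> E"
  shows "has_bipartite_hole V E s t"
proof -
  obtain S' T' where "S' \<subseteq> S" "card S' = s" "T' \<subseteq> T" "card T' = t"
    using assms(4,5) by (meson obtain_subset_with_card_n)
  then show ?thesis
    unfolding has_bipartite_hole_def using assms(1-3,6)
    by - (rule exI[of _ S'], rule exI[of _ T'], simp, blast)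
qed

lemma has_bipartite_hole_commute:
  "has_bipartite_hole V E s t \<longleftrightarrow> has_bipartite_hole V E t s"
proof -
  have "has_bipartite_hole V E t s" if h: "has_bipartite_hole V E s t" for s t
  proof -
    from h obtain S T where "S \<subseteq> V" "T \<subseteq> V" "S \<inter> T = {}" "card S = s" "card T = t"
      "\<forall>x\<in>S. \<forall>y\<in>T. {x, y} \<notin> E"
      unfolding has_bipartite_hole_def by (elim exE conjE)
    then show ?thesis
      by (intro has_bipartite_holeI[of T _ S]) (simp_all add: Int_commute, metis insert_commute)
  qed
  then show ?thesis by blast
qed

section \<open>A Hamiltonicity criterion\<close>

abbreviation walk :: "'a set set \<Rightarrow> 'a list \<Rightarrow> bool" where
  "walk E \<equiv> successively (\<lambda>x y. {x, y} \<in> E)"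

definition closed_walk :: "'a set set \<Rightarrow> 'a list \<Rightarrow> bool" where
  "closed_walk E xs \<longleftrightarrow> walk E xs \<and> {last xs, hd xs} \<in> E"

lemma walk_rev: "walk E (rev xs) = walk E xs"
  by (simp add: insert_commute)

lemma cycle_edges_closed_walk:
  assumes "closed_walk E xs" "xs \<noteq> []"
  shows "cycle_edges xs \<subseteq> E"
proof
  fix e assume "e \<in> cycle_edges xs"
  then obtain i where i: "i < length xs" "e = {xs ! i, xs ! (Suc i mod length xs)}"
    unfolding cycle_edges_def by blast
  show "e \<in> E"
  proof (cases "Suc i < length xs")
    case True
    then show ?thesis
      using i assms by (simp add: closed_walk_def successively_conv_nth)
  next
    case False
    then have "i = length xs - 1" using i by auto
    then show ?thesis
      using i assms by (simp add: closed_walk_def last_conv_nth hd_conv_nth)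
  qed
qed

text \<open>The next two lemmas perform a rotation at each end of a path and close the result up. Here
  the path is cut into three segments and the first vertex is adjacent to the start of the
  middle segment, the last vertex to its end; reversing the two outer segments makes the two
  free ends adjacent as soon as the cut points \<open>last X\<close> and \<open>hd Z\<close> are.\<close>

lemma closed_walk_swap_outer:
  assumes "walk E (X @ Y @ Z)" "X \<noteq> []" "Y \<noteq> []" "Z \<noteq> []"
    and "{hd X, hd Y} \<in> E" "{last Z, last Y} \<in> E" "{last X, hd Z} \<in> E"
  shows "closed_walk E (rev X @ Y @ rev Z)"
  using assms unfolding closed_walk_def
  by (simp add: successively_append_iff walk_rev hd_rev last_rev insert_commute del: successively_rev)

text \<open>The crossing variant: the chord from the last vertex lands before the chord from the first
  vertex, and the edge needed to close up joins the ends of the first two segments.\<close>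

lemma closed_walk_swap_inner:
  assumes "walk E (X @ Y @ Z)" "X \<noteq> []" "Y \<noteq> []" "Z \<noteq> []"
    and "{last Z, hd Y} \<in> E" "{hd X, hd Z} \<in> E" "{last X, last Y} \<in> E"
  shows "closed_walk E (rev Y @ rev Z @ X)"
  using assms unfolding closed_walk_def
  by (simp add: successively_append_iff walk_rev hd_rev last_rev insert_commute del: successively_rev)

text \<open>Cutting the closed walk open at the vertex with the outside neighbour gives a path that can
  be prolonged; this is why a longest path whose vertex set carries a cycle has no edge leaving
  its vertex set.\<close>

lemma walk_leaving_closed_walk:
  assumes "closed_walk E xs" "distinct xs" "x \<in> set xs" "z \<notin> set xs" "{x, z} \<in> E"
  shows "\<exists>ys. walk E ys \<and> distinct ys \<and> set ys = insert z (set xs)"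
proof -
  obtain X Y where xs: "xs = X @ x # Y" using assms(3) by (meson split_list)
  have "walk E (Y @ X @ [x, z])"
    using assms(1,5) unfolding closed_walk_def xs
    by (cases "X = []"; cases "Y = []") (auto simp: successively_append_iff successively_Cons)
  then show ?thesis
    using assms(2,4) xs by (intro exI[of _ "Y @ X @ [x, z]"]) auto
qed

text \<open>Posa rotation at both ends at once. Choose a threshold \<open>m\<close> on the path where the first
  vertex has seen \<open>s\<close> of its neighbours. If the last vertex has \<open>t\<close> neighbours at or behind \<open>m\<close>,
  the predecessors of the former and the successors of the latter are two disjoint sets of
  sizes at least \<open>s\<close> and \<open>t\<close>, and every edge between them closes a cycle by
  \<open>closed_walk_swap_outer\<close>. Otherwise the last vertex has \<open>s\<close> neighbours before \<open>m\<close> and the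
  first has \<open>t\<close> at or behind \<open>m\<close>, and the predecessors on both sides serve for
  \<open>closed_walk_swap_inner\<close>. Since there is no hole, such an edge exists. The shifts stay on
  the path unless the two ends are adjacent, when the path closes up by itself.\<close>

lemma crossing_edge_closed_walk:
  fixes xs :: "'a list"
  assumes "simple_graph V E" and "\<not> has_bipartite_hole V E s t" and "s \<ge> 1" "t \<ge> 1"
    and walk: "walk E xs" and dist: "distinct xs" and "xs \<noteq> []" and "set xs \<subseteq> V"
    and hd: "neighbours E (hd xs) \<subseteq> set xs" "card (neighbours E (hd xs)) \<ge> s + t - 1"
    and last: "neighbours E (last xs) \<subseteq> set xs" "card (neighbours E (last xs)) \<ge> s + t - 1"
  shows "\<exists>ys. closed_walk E ys \<and> distinct ys \<and> set ys = set xs"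
proof (cases "{last xs, hd xs} \<in> E")
  case True
  then show ?thesis using walk dist by (auto simp: closed_walk_def)
next
  case False
  define l where "l = length xs"
  have l: "l > 0" using \<open>xs \<noteq> []\<close> by (simp add: l_def)
  define N where "N x = {i. i < l \<and> {x, xs ! i} \<in> E}" for x
  have fin [simp]: "finite (N x)" for x by (simp add: N_def)
  have card_N: "card (N x) \<ge> s + t - 1"
    if "neighbours E x \<subseteq> set xs" "card (neighbours E x) \<ge> s + t - 1" for x
  proof -
    have "neighbours E x \<subseteq> (!) xs ` N x"
      using that(1) unfolding N_def neighbours_def l_def
      by (force simp: in_set_conv_nth)
    then have "card (neighbours E x) \<le> card (N x)"
      by (simp add: surj_card_le)
    then show ?thesis using that by simp
  qed
  have inj: "inj_on ((!) xs) {..<l}" using dist by (auto simp: inj_on_nth l_def)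
  have hd0: "hd xs = xs ! 0" and last0: "last xs = xs ! (l - 1)"
    using \<open>xs \<noteq> []\<close> by (simp_all add: hd_conv_nth last_conv_nth l_def)
  have loop: "{x, x} \<notin> E" for x using edge_in_simple_graph(3)[OF assms(1)] by blast
  have N_hd: "i \<ge> 1" if "i \<in> N (hd xs)" for i
    using that loop hd0 by (cases i) (auto simp: N_def)
  have N_last: "i \<ge> 1 \<and> Suc i < l" if "i \<in> N (last xs)" for i
  proof -
    have "i \<noteq> 0" using that False hd0 unfolding N_def by (metis (mono_tags) mem_Collect_eq)
    moreover have "i \<noteq> l - 1" using that loop last0 by (auto simp: N_def)
    ultimately show ?thesis using that by (auto simp: N_def)
  qed
  have NlE: "i < l" "{x, xs ! i} \<in> E" if "i \<in> N x" for i x using that by (auto simp: N_def)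

  have split3: "xs = take i xs @ (drop i (take j xs)) @ drop j xs" if "i \<le> j" for i j
    using that append_take_drop_id[of i "take j xs"] append_take_drop_id[of j xs]
    by (simp add: min_absorb1 flip: append_assoc)
  have ends: "hd (take i xs) = hd xs" "last (take i xs) = xs ! (i - 1)"
     "hd (drop i (take j xs)) = xs ! i" "last (drop i (take j xs)) = xs ! (j - 1)"
     "hd (drop j xs) = xs ! j" "last (drop j xs) = last xs"
     "take i xs \<noteq> []" "drop i (take j xs) \<noteq> []" "drop j xs \<noteq> []"
     if "1 \<le> i" "i < j" "j < l" for i j
    using that \<open>xs \<noteq> []\<close>
    by (auto simp: l_def hd_take last_conv_nth hd_drop_conv_nth)
  have img: "card ((\<lambda>i. xs ! f i) ` I) = card I"
    if "inj_on f I" "f ` I \<subseteq> {..<l}" for f :: "nat \<Rightarrow> nat" and I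
  proof -
    have "inj_on ((!) xs \<circ> f) I"
      using that inj by (meson comp_inj_on inj_on_subset)
    then show ?thesis using card_image[of "(!) xs \<circ> f" I] by (simp add: comp_def)
  qed
  \<comment> \<open>Both cases need an edge between shifted position sets; \<open>f\<close> and \<open>g\<close> are the shifts.\<close>
  have hole: "\<exists>i\<in>I. \<exists>j\<in>J. {xs ! f i, xs ! g j} \<in> E"
    if I: "card I \<ge> s" "inj_on f I" "f ` I \<subseteq> {..<l}" and J: "card J \<ge> t" "inj_on g J" "g ` J \<subseteq> {..<l}"
      and lt: "\<And>i j. i \<in> I \<Longrightarrow> j \<in> J \<Longrightarrow> f i < g j" for I J :: "nat set" and f g
  proof (rule ccontr)
    assume no: "\<not> ?thesis"
    have "has_bipartite_hole V E s t"
    proof (rule has_bipartite_holeI)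
      show "(\<lambda>i. xs ! f i) ` I \<subseteq> V" "(\<lambda>i. xs ! g i) ` J \<subseteq> V"
        using I J \<open>set xs \<subseteq> V\<close> by (auto simp: l_def subset_iff)
      have "xs ! f i \<noteq> xs ! g j" if "i \<in> I" "j \<in> J" for i j
        using that lt[OF that] I(3) J(3) inj by (metis image_subset_iff inj_onD less_irrefl)
      then show "(\<lambda>i. xs ! f i) ` I \<inter> (\<lambda>i. xs ! g i) ` J = {}" by blast
      show "s \<le> card ((\<lambda>i. xs ! f i) ` I)" "t \<le> card ((\<lambda>i. xs ! g i) ` J)"
        using I(1) J(1) img[OF I(2,3)] img[OF J(2,3)] by simp_all
    qed (use no in blast)
    then show False using assms(2) by blast
  qed

  have ex: "\<exists>m. card (N (hd xs) \<inter> {..m}) \<ge> s"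
  proof -
    have "N (hd xs) \<inter> {..l} = N (hd xs)" by (auto simp: N_def)
    then show ?thesis using card_N[OF hd] assms(3,4) by (intro exI[of _ l]) simp
  qed
  \<comment> \<open>Minimality leaves at most \<open>s - 1\<close> neighbours strictly before \<open>m\<close>, so \<open>t\<close> remain from \<open>m\<close> on.\<close>
  define m where "m = (LEAST m. card (N (hd xs) \<inter> {..m}) \<ge> s)"
  have m: "card (N (hd xs) \<inter> {..m}) \<ge> s"
    unfolding m_def using ex by (rule LeastI_ex)
  have m': "card (N (hd xs) \<inter> {..<m}) < s"
  proof (cases m)
    case 0 then show ?thesis using assms(3) by simp
  next
    case (Suc m')
    then have "\<not> card (N (hd xs) \<inter> {..m'}) \<ge> s"
      using not_less_Least[of m' "\<lambda>m. card (N (hd xs) \<inter> {..m}) \<ge> s"] m_def by simp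
    then show ?thesis using Suc by (simp add: lessThan_Suc_atMost)
  qed
  have split: "card (N x) = card (N x \<inter> {..<m}) + card (N x \<inter> {m..})" for x
  proof -
    have "N x = (N x \<inter> {..<m}) \<union> (N x \<inter> {m..})" by auto
    then show ?thesis
      by (metis (no_types, lifting) card_Un_disjoint disjoint_iff fin finite_Int Int_iff
          atLeast_iff lessThan_iff not_less)
  qed
  show ?thesis
  proof (cases "card (N (last xs) \<inter> {m..}) \<ge> t")
    case True
    have "\<exists>i\<in>N (hd xs) \<inter> {..m}. \<exists>j\<in>N (last xs) \<inter> {m..}. {xs ! (i - 1), xs ! Suc j} \<in> E"
    proof (rule hole[OF m _ _ True])
      show "inj_on (\<lambda>i. i - 1) (N (hd xs) \<inter> {..m})"
        using N_hd by (intro inj_on_diff_nat) auto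
      show "(\<lambda>i. i - 1) ` (N (hd xs) \<inter> {..m}) \<subseteq> {..<l}" using NlE(1) by fastforce
      show "Suc ` (N (last xs) \<inter> {m..}) \<subseteq> {..<l}" using N_last by auto
      show "i - 1 < Suc j" if "i \<in> N (hd xs) \<inter> {..m}" "j \<in> N (last xs) \<inter> {m..}" for i j
        using that by auto
    qed simp
    then obtain i j where ij: "i \<in> N (hd xs)" "i \<le> m" "j \<in> N (last xs)" "m \<le> j"
      "{xs ! (i - 1), xs ! Suc j} \<in> E" by auto
    have o: "1 \<le> i" "i < Suc j" "Suc j < l" using ij(2,4) N_hd[OF ij(1)] N_last[OF ij(3)] by linarith+
    define X Y Z where "X = take i xs" and "Y = drop i (take (Suc j) xs)" and "Z = drop (Suc j) xs"
    have xs: "xs = X @ Y @ Z" unfolding X_def Y_def Z_def by (rule split3) (use o in simp)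
    have "closed_walk E (rev X @ Y @ rev Z)"
      using walk ends[OF o] ij(5) NlE(2)[OF ij(1)] NlE(2)[OF ij(3)]
      by (intro closed_walk_swap_outer) (simp_all add: xs[symmetric], simp_all add: X_def Y_def Z_def)
    moreover have "distinct (rev X @ Y @ rev Z)" using dist by (subst (asm) xs) auto
    moreover have "set (rev X @ Y @ rev Z) = set xs" by (subst xs) auto
    ultimately show ?thesis by blast
  next
    case False
    then have s: "card (N (last xs) \<inter> {..<m}) \<ge> s"
      using split[of "last xs"] card_N[OF last] by linarith
    have t: "card (N (hd xs) \<inter> {m..}) \<ge> t"
      using split[of "hd xs"] card_N[OF hd] m' by linarith
    have "\<exists>i\<in>N (last xs) \<inter> {..<m}. \<exists>j\<in>N (hd xs) \<inter> {m..}. {xs ! (i - 1), xs ! (j - 1)} \<in> E"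
    proof (rule hole[OF s _ _ t])
      show "inj_on (\<lambda>i. i - 1) (N (last xs) \<inter> {..<m})"
        using N_last by (intro inj_on_diff_nat) auto
      show "inj_on (\<lambda>i. i - 1) (N (hd xs) \<inter> {m..})"
        using N_hd by (intro inj_on_diff_nat) auto
      show "(\<lambda>i. i - 1) ` (N (last xs) \<inter> {..<m}) \<subseteq> {..<l}"
         "(\<lambda>i. i - 1) ` (N (hd xs) \<inter> {m..}) \<subseteq> {..<l}" using NlE(1) by fastforce+
      show "i - 1 < j - 1" if "i \<in> N (last xs) \<inter> {..<m}" "j \<in> N (hd xs) \<inter> {m..}" for i j
        using that N_last[of i] by auto
    qed
    then obtain i j where ij: "i \<in> N (last xs)" "i < m" "j \<in> N (hd xs)" "m \<le> j"
      "{xs ! (i - 1), xs ! (j - 1)} \<in> E" by auto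
    have o: "1 \<le> i" "i < j" "j < l" using ij(2,4) N_last[OF ij(1)] NlE(1)[OF ij(3)] by linarith+
    define X Y Z where "X = take i xs" and "Y = drop i (take j xs)" and "Z = drop j xs"
    have xs: "xs = X @ Y @ Z" unfolding X_def Y_def Z_def by (rule split3) (use o in simp)
    have "closed_walk E (rev Y @ rev Z @ X)"
      using walk ends[OF o] ij(5) NlE(2)[OF ij(1)] NlE(2)[OF ij(3)]
      by (intro closed_walk_swap_inner) (simp_all add: xs[symmetric], simp_all add: X_def Y_def Z_def)
    moreover have "distinct (rev Y @ rev Z @ X)" using dist by (subst (asm) xs) auto
    moreover have "set (rev Y @ rev Z @ X) = set xs" by (subst xs) auto
    ultimately show ?thesis by blast
  qed
qed

text \<open>The theorem of McDiarmid and Yolov. A longest path contains all neighbours of its ends, so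
  its vertex set \<open>W\<close> carries a cycle by the rotation argument, and by maximality no edge leaves
  \<open>W\<close>. If \<open>W\<close> were not everything, both \<open>W\<close> and its complement would contain a vertex
  with all its neighbours, hence at least \<open>s + t\<close> vertices, and would form a hole.\<close>

theorem hamilton_cycle_if_no_hole:
  assumes G: "simple_graph V E" and "V \<noteq> {}"
    and hole: "\<not> has_bipartite_hole V E s t" and st: "s \<ge> 1" "t \<ge> 1"
    and deg: "\<And>v. v \<in> V \<Longrightarrow> degree E v \<ge> s + t - 1" "\<And>v. v \<in> V \<Longrightarrow> degree E v \<ge> 2"
  shows "\<exists>xs. hamilton_cycle V E xs"
proof -
  have "finite V" using G by (simp add: simple_graph_def)
  define P where "P xs \<longleftrightarrow> walk E xs \<and> distinct xs \<and> set xs \<subseteq> V \<and> xs \<noteq> []" for xs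
  have len: "length xs = card (set xs)" if "P xs" for xs
    using that by (simp add: P_def distinct_card)
  obtain v where "v \<in> V" using \<open>V \<noteq> {}\<close> by blast
  then have "P [v]" by (simp add: P_def)
  moreover have "length xs < Suc (card V)" if "P xs" for xs
    using that len[OF that] \<open>finite V\<close> by (simp add: P_def card_mono less_Suc_eq_le)
  ultimately obtain xs where xs: "P xs" and max: "\<And>ys. P ys \<Longrightarrow> length ys \<le> length xs"
    using ex_has_greatest_nat[of P "[v]" length "Suc (card V)"] by (blast intro: less_imp_le)
  have ne: "xs \<noteq> []" and w: "walk E xs" and d: "distinct xs" and sub: "set xs \<subseteq> V"
    using xs by (auto simp: P_def)
  have inV: "neighbours E v \<subseteq> V" for v using neighbours_subset[OF G] by blast
  have dc: "card (neighbours E v) \<ge> s + t - 1" "card (neighbours E v) \<ge> 2" if "v \<in> V" for v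
    using deg that degree_eq_card_neighbours[OF G] by metis+
  have longer: False if "walk E ys" "distinct ys" "set ys = insert z (set xs)" "z \<in> V - set xs" for ys z
  proof -
    have "P ys" using that sub by (auto simp: P_def)
    moreover have "length ys = Suc (length xs)"
      using that d distinct_card[of ys] distinct_card[of xs] by simp
    ultimately show False using max by fastforce
  qed
  have nhd: "neighbours E (hd xs) \<subseteq> set xs"
  proof
    fix z assume z: "z \<in> neighbours E (hd xs)"
    show "z \<in> set xs"
    proof (rule ccontr)
      assume "z \<notin> set xs"
      moreover have "walk E (z # xs)"
        using w z ne by (simp add: successively_Cons neighbours_def insert_commute)
      ultimately show False
        using longer[of "z # xs" z] d z inV by auto
    qed
  qed
  have nlast: "neighbours E (last xs) \<subseteq> set xs"
  proof
    fix z assume z: "z \<in> neighbours E (last xs)"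
    show "z \<in> set xs"
    proof (rule ccontr)
      assume "z \<notin> set xs"
      moreover have "walk E (xs @ [z])"
        using w z ne by (simp add: successively_append_iff neighbours_def)
      ultimately show False
        using longer[of "xs @ [z]" z] d z inV by auto
    qed
  qed
  have "hd xs \<in> V" "last xs \<in> V" using ne sub by auto
  then obtain ys where ys: "closed_walk E ys" "distinct ys" "set ys = set xs"
    using crossing_edge_closed_walk[OF G hole st w d ne sub nhd _ nlast] dc by blast
  have big: "card W \<ge> s + t" "card W \<ge> 3"
    if "v \<in> W" "neighbours E v \<subseteq> W" "W \<subseteq> V" for v W
  proof -
    have "finite W" using that(3) \<open>finite V\<close> finite_subset by blast
    moreover have "insert v (neighbours E v) \<subseteq> W" "v \<notin> neighbours E v"
      using that neighbours_subset[OF G, of v] by auto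
    ultimately have "Suc (card (neighbours E v)) \<le> card W"
      by (metis card_insert_disjoint card_mono finite_insert finite_subset)
    then show "card W \<ge> s + t" "card W \<ge> 3" using dc[of v] that st by auto
  qed
  have closed: "z \<in> set xs" if xz: "x \<in> set xs" "{x, z} \<in> E" for x z
  proof (rule ccontr)
    assume "z \<notin> set xs"
    moreover from this obtain zs where "walk E zs" "distinct zs" "set zs = insert z (set xs)"
      using walk_leaving_closed_walk[OF ys(1,2), of x z] xz ys(3) by auto
    ultimately show False
      using longer edge_in_simple_graph(2)[OF G xz(2)] by blast
  qed
  have "V \<subseteq> set xs"
  proof (rule ccontr)
    assume "\<not> V \<subseteq> set xs"
    then obtain v where v: "v \<in> V - set xs" by blast
    have "neighbours E v \<subseteq> V - set xs"
    proof
      fix w assume "w \<in> neighbours E v"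
      then have "{w, v} \<in> E" "w \<in> V"
        using inV by (auto simp: neighbours_def insert_commute)
      then show "w \<in> V - set xs" using closed v by blast
    qed
    then have "card (V - set xs) \<ge> s + t" using big[of v "V - set xs"] v by simp
    moreover have "card (set xs) \<ge> s + t" using big(1)[of "hd xs" "set xs"] nhd ne sub by simp
    ultimately have "has_bipartite_hole V E s t"
      using sub closed by (intro has_bipartite_holeI[of "set xs" _ "V - set xs"]) auto
    then show False using hole by blast
  qed
  then have "set ys = V" using sub ys by auto
  moreover have "length ys \<ge> 3"
    using big(2)[of "hd xs" "set xs"] nhd ne sub ys distinct_card[of ys] by simp
  moreover have "cycle_edges ys \<subseteq> E"
    using cycle_edges_closed_walk[OF ys(1)] \<open>length ys \<ge> 3\<close> by fastforce
  ultimately show ?thesis using ys unfolding hamilton_cycle_def by blast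
qed

section \<open>Edges and degrees of a cycle\<close>

lemma inj_on_cyclic_Suc: "inj_on (\<lambda>i. Suc i mod n) {..<n}"
  by (auto simp: inj_on_def mod_Suc split: if_splits)

lemma degree_cycle_edges:
  assumes "distinct xs"
  shows "degree (cycle_edges xs) v \<le> 2"
proof -
  let ?n = "length xs"
  define I where "I = {i. i < ?n \<and> xs ! i = v}"
  define J where "J = {i. i < ?n \<and> xs ! (Suc i mod ?n) = v}"
  have "card I \<le> Suc 0"
    using assms by (subst card_le_Suc0_iff_eq) (auto simp: I_def nth_eq_iff_index_eq)
  moreover have "card J \<le> Suc 0"
  proof (subst card_le_Suc0_iff_eq)
    show "\<forall>i\<in>J. \<forall>j\<in>J. i = j"
    proof (intro ballI)
      fix i j assume ij: "i \<in> J" "j \<in> J"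
      then have "?n > 0" by (auto simp: J_def)
      then have "Suc i mod ?n = Suc j mod ?n"
        using ij assms by (auto simp: J_def nth_eq_iff_index_eq)
      then show "i = j"
        using ij inj_on_cyclic_Suc[of ?n] by (auto simp: J_def inj_on_def)
    qed
  qed (simp add: J_def)
  ultimately have IJ: "card (I \<union> J) \<le> 2" using card_Un_le[of I J] by linarith
  have fin: "finite (I \<union> J)" by (simp add: I_def J_def)
  have "{e \<in> cycle_edges xs. v \<in> e} \<subseteq> (\<lambda>i. {xs ! i, xs ! (Suc i mod ?n)}) ` (I \<union> J)"
    by (auto simp: cycle_edges_def I_def J_def)
  then have "degree (cycle_edges xs) v \<le> card (I \<union> J)"
    unfolding degree_def using fin by (rule surj_card_le[rotated])
  then show ?thesis using IJ by linarith
qed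

lemma card_cycle_edges:
  assumes "distinct xs" "length xs \<ge> 3"
  shows "card (cycle_edges xs) = length xs"
proof -
  let ?n = "length xs" and ?f = "\<lambda>i. {xs ! i, xs ! (Suc i mod length xs)}"
  have "inj_on ?f {..<?n}"
  proof (rule inj_onI)
    fix i j assume ij: "i \<in> {..<?n}" "j \<in> {..<?n}" and "?f i = ?f j"
    moreover have "Suc i mod ?n < ?n" "Suc j mod ?n < ?n" using assms(2) by (auto intro: mod_less_divisor)
    ultimately have "i = j \<or> i = Suc j mod ?n \<and> Suc i mod ?n = j"
      using assms(1) by (auto simp: doubleton_eq_iff nth_eq_iff_index_eq)
    then show "i = j"
      using assms(2) ij by (auto simp: mod_Suc split: if_splits)
  qed
  moreover have "cycle_edges xs = ?f ` {..<?n}" by (auto simp: cycle_edges_def)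
  ultimately show ?thesis by (simp add: card_image)
qed

section \<open>Holes after deleting a sparse graph\<close>

text \<open>Lowering the upper index by one costs at most a factor 2 as long as it stays at least
  \<open>2 * s\<close>. The factor 3 in the upper index is what leaves room for \<open>s\<close> such steps.\<close>

lemma binomial_le_power2_mult:
  assumes "i \<le> s"
  shows "(3 * s choose s) \<le> 2 ^ i * ((3 * s - i) choose s)"
  using assms
proof (induction i)
  case (Suc i)
  define n where "n = 3 * s - i"
  have n: "n > 0" "2 * s \<le> n" "3 * s - Suc i = n - 1" using Suc.prems by (auto simp: n_def)
  have "n * (n choose s) \<le> 2 * (n - s) * (n choose s)"
    using n(2) by (intro mult_right_mono) linarith+
  also have "\<dots> = n * (2 * ((n - 1) choose s))"
    using binomial_absorb_comp[of n s] by simp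
  finally have "(n choose s) \<le> 2 * ((n - 1) choose s)" using n by simp
  then have "2 ^ i * (n choose s) \<le> 2 ^ i * (2 * ((n - 1) choose s))" by (rule mult_left_mono) simp
  moreover have "(3 * s choose s) \<le> 2 ^ i * (n choose s)"
    using Suc by (simp add: n_def)
  ultimately have "(3 * s choose s) \<le> 2 ^ i * (2 * ((n - 1) choose s))" by (rule order_trans[rotated])
  then show ?case unfolding n(3) by (simp add: mult_ac)
qed simp

text \<open>The heart of the upper bound, with the logarithm coming from the freedom in \<open>l\<close>. Suppose
  \<open>(S, T)\<close> is a hole after the removal. All edges of the original graph between \<open>S\<close> and \<open>T\<close>
  lie in \<open>R\<close>, so there are at most \<open>3 * s * D\<close> of them, and at most
  \<open>3 * s * D div Suc l\<close> vertices of \<open>T\<close> are heavy, that is, have more than \<open>l\<close> neighbours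
  in \<open>S\<close>. A light vertex has no neighbour in a proportion at least \<open>2 ^ - l\<close> of the
  \<open>s\<close>-subsets of \<open>S\<close>, while each \<open>s\<close>-subset has fewer than \<open>t\<close> vertices without
  neighbours in it; so there are fewer than \<open>2 ^ l * t\<close> light vertices.\<close>

lemma no_hole_after_sparse_removal:
  assumes G: "simple_graph V E" and hole: "\<not> has_bipartite_hole V E s t" and "t \<ge> 1"
    and R: "R \<subseteq> E" and deg: "\<And>v. degree R v \<le> D" and "l \<le> s"
    and t': "t' \<ge> 3 * s * D div Suc l + 2 ^ l * t"
  shows "\<not> has_bipartite_hole V (E - R) (3 * s) t'"
proof
  assume "has_bipartite_hole V (E - R) (3 * s) t'"
  then obtain S T where sub: "S \<subseteq> V" "T \<subseteq> V" "S \<inter> T = {}" and card: "card S = 3 * s" "card T = t'"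
    and no: "\<forall>x\<in>S. \<forall>y\<in>T. {x, y} \<notin> E - R"
    unfolding has_bipartite_hole_def by (elim exE conjE)
  have "finite V" using G by (simp add: simple_graph_def)
  then have fin: "finite S" "finite T" using sub(1,2) by (blast intro: finite_subset)+
  have GR: "simple_graph V R" using G R unfolding simple_graph_def by blast
  define M where "M v = {x \<in> S. {x, v} \<in> E}" for v
  have finM: "finite (M v)" for v using fin by (simp add: M_def)
  have "(\<Sum>v\<in>T. card (M v)) = (\<Sum>x\<in>S. card {v \<in> T. {x, v} \<in> E})"
    unfolding M_def using fin
    by (intro sum_multicount_gen[of T S "\<lambda>v x. {x, v} \<in> E"]) auto
  also have "\<dots> \<le> (\<Sum>x\<in>S. D)"
  proof (rule sum_mono)
    fix x assume "x \<in> S"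
    then have "{v \<in> T. {x, v} \<in> E} \<subseteq> neighbours R x"
      using no by (auto simp: neighbours_def)
    then have "card {v \<in> T. {x, v} \<in> E} \<le> degree R x"
      by (simp add: card_mono degree_eq_card_neighbours[OF GR] finite_neighbours[OF GR])
    then show "card {v \<in> T. {x, v} \<in> E} \<le> D" using deg[of x] by linarith
  qed
  finally have sum: "(\<Sum>v\<in>T. card (M v)) \<le> 3 * s * D" by (simp add: card)
  define heavy light where "heavy = {v \<in> T. l < card (M v)}" and "light = {v \<in> T. card (M v) \<le> l}"
  have fhl: "finite heavy" "finite light" using fin by (auto simp: heavy_def light_def)
  have "Suc l * card heavy = (\<Sum>v\<in>heavy. Suc l)" by simp
  also have "\<dots> \<le> (\<Sum>v\<in>heavy. card (M v))" by (rule sum_mono) (auto simp: heavy_def)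
  also have "\<dots> \<le> (\<Sum>v\<in>T. card (M v))" using fin by (intro sum_mono2) (auto simp: heavy_def)
  finally have "card heavy * Suc l \<le> 3 * s * D" using sum by (simp add: mult.commute)
  then have heavy: "card heavy \<le> 3 * s * D div Suc l"
    by (simp add: less_eq_div_iff_mult_less_eq)
  define P where "P = {X. X \<subseteq> S \<and> card X = s}"
  have finP: "finite P" and cardP: "card P = (3 * s choose s)"
    using fin n_subsets[of S s] by (auto simp: P_def card)
  have "card light * ((3 * s - l) choose s) = (\<Sum>v\<in>light. (3 * s - l) choose s)" by simp
  also have "\<dots> \<le> (\<Sum>v\<in>light. card {X \<in> P. X \<inter> M v = {}})"
  proof (rule sum_mono)
    fix v assume v: "v \<in> light"
    have "{X \<in> P. X \<inter> M v = {}} = {X. X \<subseteq> S - M v \<and> card X = s}"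
      by (auto simp: P_def)
    also have "card \<dots> = (card (S - M v) choose s)"
      using fin by (intro n_subsets) auto
    also have "card (S - M v) = 3 * s - card (M v)"
      using finM by (subst card_Diff_subset) (auto simp: M_def card)
    finally show "((3 * s - l) choose s) \<le> card {X \<in> P. X \<inter> M v = {}}"
      using v by (simp add: binomial_right_mono diff_le_mono2 light_def)
  qed
  also have "\<dots> = (\<Sum>X\<in>P. card {v \<in> light. X \<inter> M v = {}})"
    using fhl finP by (intro sum_multicount_gen[of light P "\<lambda>v X. X \<inter> M v = {}"]) auto
  also have "\<dots> \<le> (\<Sum>X\<in>P. t - 1)"
  proof (rule sum_mono)
    fix X assume X: "X \<in> P"
    show "card {v \<in> light. X \<inter> M v = {}} \<le> t - 1"
    proof (rule ccontr)
      assume "\<not> ?thesis"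
      then have "t \<le> card {v \<in> light. X \<inter> M v = {}}" by simp
      then have "has_bipartite_hole V E s t"
        using X sub by (intro has_bipartite_holeI[of X _ "{v \<in> light. X \<inter> M v = {}}"])
          (auto simp: P_def light_def M_def)
      then show False using hole by blast
    qed
  qed
  also have "\<dots> = (3 * s choose s) * (t - 1)" by (simp add: cardP)
  also have "\<dots> \<le> 2 ^ l * ((3 * s - l) choose s) * (t - 1)"
    using binomial_le_power2_mult[OF \<open>l \<le> s\<close>] by (rule mult_right_mono) simp
  finally have "card light * ((3 * s - l) choose s) \<le> (2 ^ l * (t - 1)) * ((3 * s - l) choose s)"
    by (simp add: mult_ac)
  moreover have "((3 * s - l) choose s) > 0" using \<open>l \<le> s\<close> by simp
  ultimately have "card light \<le> 2 ^ l * (t - 1)" by simp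
  also have "\<dots> < 2 ^ l * t" using \<open>t \<ge> 1\<close> by simp
  finally have "card light < 2 ^ l * t" .
  moreover have "card T = card heavy + card light"
  proof -
    have "T = heavy \<union> light" "heavy \<inter> light = {}" by (auto simp: heavy_def light_def)
    then show ?thesis using fhl by (simp add: card_Un_disjoint)
  qed
  ultimately show False using heavy t' card by linarith
qed

section \<open>Removing Hamilton cycles greedily\<close>

text \<open>The roles of the two parts are symmetric, so the smaller one can be put first.\<close>

lemma bipartite_hole_number_witness:
  assumes "finite V"
  obtains s t where "s \<ge> 1" "s \<le> t" "bipartite_hole_number V E = s + t - 1"
    "\<not> has_bipartite_hole V E s t"
proof -
  let ?P = "\<lambda>r. \<exists>s t. s \<ge> 1 \<and> t \<ge> 1 \<and> r = s + t - 1 \<and> \<not> has_bipartite_hole V E s t"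
  have "\<not> has_bipartite_hole V E (Suc (card V)) 1"
  proof
    assume "has_bipartite_hole V E (Suc (card V)) 1"
    then obtain S where "S \<subseteq> V" "card S = Suc (card V)"
      unfolding has_bipartite_hole_def by (elim exE conjE)
    then show False using card_mono[OF assms, of S] by simp
  qed
  then have "?P (Suc (card V))" by (intro exI[of _ "Suc (card V)"] exI[of _ 1]) simp
  then have "?P (bipartite_hole_number V E)"
    unfolding bipartite_hole_number_def by (rule LeastI)
  then obtain s t where st: "s \<ge> 1" "t \<ge> 1" "bipartite_hole_number V E = s + t - 1"
    "\<not> has_bipartite_hole V E s t" by (elim exE conjE)
  show thesis
  proof (cases "s \<le> t")
    case True then show thesis using that st by simp
  next
    case False
    then show thesis using that[of t s] st has_bipartite_hole_commute[of V E s t] by simp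
  qed
qed

lemma degree_Diff:
  assumes "finite E" "finite R"
  shows "degree E v \<le> degree (E - R) v + degree R v"
proof -
  have "{e \<in> E. v \<in> e} \<subseteq> {e \<in> E - R. v \<in> e} \<union> {e \<in> R. v \<in> e}" by blast
  then have "degree E v \<le> card ({e \<in> E - R. v \<in> e} \<union> {e \<in> R. v \<in> e})"
    unfolding degree_def using assms by (intro card_mono) auto
  also have "\<dots> \<le> degree (E - R) v + degree R v"
    unfolding degree_def by (rule card_Un_le)
  finally show ?thesis .
qed

lemma degree_UN:
  assumes "finite I"
  shows "degree (\<Union>i\<in>I. C i) v \<le> (\<Sum>i\<in>I. degree (C i) v)"
proof -
  have "{e \<in> \<Union>i\<in>I. C i. v \<in> e} = (\<Union>i\<in>I. {e \<in> C i. v \<in> e})" by blast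
  then show ?thesis unfolding degree_def using card_UN_le[OF assms, of "\<lambda>i. {e \<in> C i. v \<in> e}"] by simp
qed

lemma finite_edges: "simple_graph V E \<Longrightarrow> finite E"
  using finite_subset[of E "Pow V"] by (auto simp: simple_graph_def)

text \<open>Hamilton cycles are removed greedily. The cycles taken so far form a graph of maximum degree
  at most \<open>2 * k\<close>, so what remains has only small holes by \<open>no_hole_after_sparse_removal\<close>
  and still has large degrees; the criterion \<open>hamilton_cycle_if_no_hole\<close> gives the next
  cycle. The parameter \<open>l\<close> balances the two kinds of vertices counted there.\<close>

lemma forces_hamilton_cyclesI:
  assumes d: "d \<ge> 8 * k + 3 * a + 6 * k * a div Suc l + 2 ^ l * a"
  shows "forces_hamilton_cycles a k d"
  unfolding forces_hamilton_cycles_def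
proof (intro allI impI)
  fix V :: "nat set" and E
  assume G: "simple_graph V E" and V3: "card V \<ge> 3" and hn: "bipartite_hole_number V E \<le> a"
    and md: "min_degree V E \<ge> d"
  have "finite V" using G by (simp add: simple_graph_def)
  then obtain s t where st: "s \<ge> 1" "s \<le> t" "s + t - 1 \<le> a" and hole: "\<not> has_bipartite_hole V E s t"
    using bipartite_hole_number_witness[of V E] hn by metis
  have "V \<noteq> {}" using V3 by auto
  have dE: "degree E v \<ge> d" if "v \<in> V" for v
    using md that \<open>finite V\<close> unfolding min_degree_def
    by (meson Min_le finite_imageI imageI order_trans)
  have finE: "finite E" by (rule finite_edges[OF G])
  \<comment> \<open>The counting lemma allows at most \<open>s\<close>; if \<open>s\<close> is this small, few heavy vertices remain anyway.\<close>
  define l' where "l' = min s l"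
  define t' where "t' = 3 * s * (2 * k) div Suc l' + 2 ^ l' * t"
  have "3 * s * (2 * k) div Suc l' \<le> 6 * k + 6 * k * a div Suc l"
  proof (cases "s \<le> l")
    case True
    have "3 * s * (2 * k) \<le> 6 * k * Suc s" by simp
    then have "3 * s * (2 * k) div Suc s \<le> 6 * k * Suc s div Suc s" by (rule div_le_mono)
    also have "\<dots> = 6 * k" by (rule nonzero_mult_div_cancel_right) simp
    finally show ?thesis using True by (simp add: l'_def)
  next
    case False
    have "s \<le> a" using st by linarith
    then have "3 * s * (2 * k) \<le> 6 * k * a" by simp
    then have "3 * s * (2 * k) div Suc l \<le> 6 * k * a div Suc l" by (rule div_le_mono)
    then show ?thesis using False by (simp add: l'_def)
  qed
  moreover have "2 ^ l' * t \<le> 2 ^ l * a"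
    using st by (intro mult_mono power_increasing) (auto simp: l'_def)
  ultimately have dt: "d \<ge> 2 * k + (3 * s + t' - 1)"
    using d st unfolding t'_def by linarith
  have "t' \<ge> 1" unfolding t'_def using st by (simp add: Suc_le_eq)
  have "\<exists>H. (\<forall>i<j. hamilton_cycle V E (H i)) \<and> disjoint_family_on (\<lambda>i. cycle_edges (H i)) {..<j}"
    if "j \<le> k" for j
    using that
  proof (induction j)
    case 0
    then show ?case by (simp add: disjoint_family_on_def)
  next
    case (Suc j)
    then obtain H where H: "\<And>i. i < j \<Longrightarrow> hamilton_cycle V E (H i)"
      and disj: "disjoint_family_on (\<lambda>i. cycle_edges (H i)) {..<j}" by auto
    define R where "R = (\<Union>i\<in>{..<j}. cycle_edges (H i))"
    have RE: "R \<subseteq> E" using H by (auto simp: R_def hamilton_cycle_def)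
    have Rdeg: "degree R v \<le> 2 * k" for v
    proof -
      have "degree R v \<le> (\<Sum>i<j. degree (cycle_edges (H i)) v)"
        unfolding R_def by (rule degree_UN) simp
      also have "\<dots> \<le> (\<Sum>i<j. 2)"
        using H by (intro sum_mono degree_cycle_edges) (auto simp: hamilton_cycle_def)
      finally show ?thesis using Suc.prems by simp
    qed
    have G': "simple_graph V (E - R)" using G by (auto simp: simple_graph_def)
    have "\<exists>xs. hamilton_cycle V (E - R) xs"
    proof (rule hamilton_cycle_if_no_hole[OF G' \<open>V \<noteq> {}\<close>])
      show "\<not> has_bipartite_hole V (E - R) (3 * s) t'"
        by (rule no_hole_after_sparse_removal[OF G hole _ RE Rdeg, of l'])
          (use st in \<open>auto simp: l'_def t'_def\<close>)
      have deg': "3 * s + t' - 1 \<le> degree (E - R) v" if "v \<in> V" for v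
      proof -
        have "finite R" using RE finE finite_subset by blast
        then have "degree E v \<le> degree (E - R) v + degree R v" by (rule degree_Diff[OF finE])
        then show ?thesis using dE[OF that] Rdeg[of v] dt by linarith
      qed
      show "3 * s + t' - 1 \<le> degree (E - R) v" if "v \<in> V" for v by (rule deg'[OF that])
      show "2 \<le> degree (E - R) v" if "v \<in> V" for v
        using deg'[OF that] st \<open>t' \<ge> 1\<close> by linarith
    qed (use st \<open>t' \<ge> 1\<close> in auto)
    then obtain xs where xs: "hamilton_cycle V (E - R) xs" by blast
    then have "hamilton_cycle V E xs" "cycle_edges xs \<inter> R = {}"
      by (auto simp: hamilton_cycle_def)
    then have "(\<forall>i<Suc j. hamilton_cycle V E ((H(j := xs)) i)) \<and>
        disjoint_family_on (\<lambda>i. cycle_edges ((H(j := xs)) i)) {..<Suc j}"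
      using H disj by (auto simp: less_Suc_eq disjoint_family_on_def R_def) blast+
    then show ?case by blast
  qed
  then show "has_disjoint_hamilton_cycles V E k"
    unfolding has_disjoint_hamilton_cycles_def by blast
qed

section \<open>Sparse graphs without holes\<close>

text \<open>Greedy choice: by double counting, some element lies in at least the fraction
  \<open>q / card U\<close> of the sets that are not hit yet.\<close>

lemma exists_hitting_set:
  assumes "finite U" and "finite F" and F: "\<And>A. A \<in> F \<Longrightarrow> A \<subseteq> U \<and> q \<le> card A"
    and "real (card F) * (1 - real q / real (card U)) ^ M < 1"
  shows "\<exists>X \<subseteq> U. card X \<le> M \<and> (\<forall>A\<in>F. A \<inter> X \<noteq> {})"
  using assms(2-4)
proof (induction M arbitrary: F)
  case 0
  then have "F = {}" by simp
  then show ?case by (intro exI[of _ "{}"]) simp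
next
  case (Suc M)
  show ?case
  proof (cases "F = {} \<or> q = 0")
    case True
    show ?thesis
    proof (cases "F = {}")
      case True
      then show ?thesis by (intro exI[of _ "{}"]) simp
    next
      case False
      then have "card F \<ge> 1" using Suc.prems(1) by (simp add: Suc_le_eq card_gt_0_iff)
      then show ?thesis using Suc.prems(3) True False by simp
    qed
  next
    case False
    then obtain A where A: "A \<in> F" by blast
    have "q \<le> card U"
      using Suc.prems(2)[OF A] card_mono[OF \<open>finite U\<close>, of A] by linarith
    then have Upos: "card U > 0" using False by simp
    define p where "p = real q / real (card U)"
    have p: "0 \<le> 1 - p" using \<open>q \<le> card U\<close> Upos by (simp add: p_def)
    define F1 where "F1 u = {A \<in> F. u \<in> A}" for u
    have "\<exists>u\<in>U. real (card F) * p \<le> real (card (F1 u))"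
    proof (rule ccontr)
      assume no: "\<not> ?thesis"
      have "q * card F \<le> (\<Sum>A\<in>F. card A)"
        using sum_mono[of F "\<lambda>_. q" card] Suc.prems(2) by (simp add: mult.commute)
      also have "\<dots> = (\<Sum>A\<in>F. card {u \<in> U. u \<in> A})"
      proof (rule sum.cong)
        fix A assume "A \<in> F"
        then have "{u \<in> U. u \<in> A} = A" using Suc.prems(2) by blast
        then show "card A = card {u \<in> U. u \<in> A}" by simp
      qed simp
      also have "\<dots> = (\<Sum>u\<in>U. card (F1 u))"
        unfolding F1_def using \<open>finite U\<close> Suc.prems(1)
        by (intro sum_multicount_gen[of F U "\<lambda>A u. u \<in> A"]) auto
      finally have "real (q * card F) \<le> (\<Sum>u\<in>U. real (card (F1 u)))"
        by (metis of_nat_le_iff of_nat_sum)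
      also have "\<dots> < (\<Sum>u\<in>U. real (card F) * p)"
        using no Upos \<open>finite U\<close> by (intro sum_strict_mono) (auto simp: not_le)
      also have "\<dots> = real (q * card F)" using Upos by (simp add: p_def)
      finally show False by simp
    qed
    then obtain u where u: "u \<in> U" "real (card F) * p \<le> real (card (F1 u))" by blast
    define F' where "F' = {A \<in> F. u \<notin> A}"
    have "F = F1 u \<union> F'" "F1 u \<inter> F' = {}" by (auto simp: F1_def F'_def)
    then have "card F = card (F1 u) + card F'"
      using Suc.prems(1) by (metis card_Un_disjoint finite_Un)
    then have "real (card F') \<le> real (card F) * (1 - p)"
      using u by (simp add: algebra_simps)
    then have "real (card F') * (1 - p) ^ M \<le> real (card F) * (1 - p) * (1 - p) ^ M"
      using p by (intro mult_right_mono) auto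
    also have "\<dots> < 1" using Suc.prems(3) by (simp add: p_def mult_ac)
    finally have "real (card F') * (1 - p) ^ M < 1" .
    then obtain X where X: "X \<subseteq> U" "card X \<le> M" "\<forall>A\<in>F'. A \<inter> X \<noteq> {}"
      using Suc.IH[of F'] Suc.prems(1,2) unfolding p_def F'_def by auto
    have "card (insert u X) \<le> Suc M"
      using X(2) card_insert_le_m1 by (metis Suc_le_mono card_insert_if card.infinite finite_insert le_SucI)
    moreover have "\<forall>A\<in>F. A \<inter> insert u X \<noteq> {}" using X(3) by (auto simp: F'_def)
    ultimately show ?thesis using u X(1) by (intro exI[of _ "insert u X"]) auto
  qed
qed

text \<open>A graph without an \<open>(s, s)\<close>-hole is a set of pairs hitting every product \<open>S \<times> T\<close> of
  disjoint \<open>s\<close>-sets. This replaces the usual random graph by a greedy one.\<close>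

lemma exists_sparse_graph_without_hole:
  assumes "finite B" and "real (card B choose s) ^ 2 * (1 - (real s / real (card B))\<^sup>2) ^ M < 1"
  shows "\<exists>H. simple_graph B H \<and> card H \<le> M \<and> \<not> has_bipartite_hole B H s s"
proof -
  define Q where "Q = {S. S \<subseteq> B \<and> card S = s}"
  define F where "F = (\<lambda>(S, T). S \<times> T) ` {(S, T) \<in> Q \<times> Q. S \<inter> T = {}}"
  have finQ: "finite Q" using assms(1) by (simp add: Q_def)
  have cardQ: "card Q = card B choose s" unfolding Q_def using assms(1) by (rule n_subsets)
  have finP: "finite {(S, T) \<in> Q \<times> Q. S \<inter> T = {}}"
    by (rule finite_subset[of _ "Q \<times> Q"]) (use finQ in auto)
  have "card F \<le> card {(S, T) \<in> Q \<times> Q. S \<inter> T = {}}"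
    unfolding F_def using finP by (rule card_image_le)
  also have "\<dots> \<le> card (Q \<times> Q)" using finQ by (intro card_mono) auto
  finally have "card F \<le> (card B choose s) ^ 2"
    by (simp add: card_cartesian_product cardQ power2_eq_square)
  then have cardF: "real (card F) \<le> real (card B choose s) ^ 2"
    by (metis of_nat_le_iff of_nat_power)
  show ?thesis
  proof (cases "F = {}")
    case True
    have "\<not> has_bipartite_hole B {} s s"
    proof
      assume "has_bipartite_hole B {} s s"
      then obtain S T where "S \<subseteq> B" "T \<subseteq> B" "S \<inter> T = {}" "card S = s" "card T = s"
        unfolding has_bipartite_hole_def by (elim exE conjE)
      then show False using True by (auto simp: F_def Q_def)
    qed
    then show ?thesis using assms(1) by (intro exI[of _ "{}"]) (simp add: simple_graph_def)
  next
    case False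
    then obtain S where "S \<subseteq> B" "card S = s" by (auto simp: F_def Q_def)
    then have "s \<le> card B" using card_mono[OF assms(1)] by blast
    then have "(real s / real (card B))\<^sup>2 \<le> 1"
      by (cases "card B = 0") (auto simp: power_le_one_iff abs_if divide_le_eq)
    then have "0 \<le> (1 - (real s / real (card B))\<^sup>2) ^ M" by simp
    then have "real (card F) * (1 - (real s / real (card B))\<^sup>2) ^ M < 1"
      using mult_right_mono[OF cardF] assms(2) by fastforce
    moreover have "real (s * s) / real (card (B \<times> B)) = (real s / real (card B))\<^sup>2"
      by (simp add: card_cartesian_product power2_eq_square)
    ultimately have "\<exists>X\<subseteq>B \<times> B. card X \<le> M \<and> (\<forall>A\<in>F. A \<inter> X \<noteq> {})"
      using assms(1) finP
      by (intro exists_hitting_set[of _ _ "s * s"])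
        (auto simp: F_def Q_def card_cartesian_product)
    then obtain X where X: "X \<subseteq> B \<times> B" "card X \<le> M" "\<forall>A\<in>F. A \<inter> X \<noteq> {}" by blast
    have finX: "finite X" using X(1) assms(1) by (meson finite_SigmaI finite_subset)
    define H where "H = (\<lambda>(x, y). {x, y}) ` {p \<in> X. fst p \<noteq> snd p}"
    have "simple_graph B H" using X(1) assms(1) by (auto simp: simple_graph_def H_def)
    moreover have "card H \<le> M"
    proof -
      have "card H \<le> card {p \<in> X. fst p \<noteq> snd p}"
        unfolding H_def using finX by (intro card_image_le) simp
      also have "\<dots> \<le> card X" using finX by (intro card_mono) auto
      finally show ?thesis using X(2) by linarith
    qed
    moreover have "\<not> has_bipartite_hole B H s s"
    proof
      assume "has_bipartite_hole B H s s"
      then obtain S T where ST: "S \<subseteq> B" "T \<subseteq> B" "S \<inter> T = {}" "card S = s" "card T = s"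
        and no: "\<forall>x\<in>S. \<forall>y\<in>T. {x, y} \<notin> H"
        unfolding has_bipartite_hole_def by (elim exE conjE)
      then have "S \<times> T \<in> F"
        unfolding F_def Q_def by (intro image_eqI[of _ _ "(S, T)"]) simp_all
      then have "(S \<times> T) \<inter> X \<noteq> {}" by (rule bspec[OF X(3)])
      then obtain x y where xy: "x \<in> S" "y \<in> T" "(x, y) \<in> X" by auto
      then have "x \<noteq> y" using ST(3) by blast
      then have "{x, y} \<in> H"
        using xy(3) unfolding H_def by (intro image_eqI[of _ _ "(x, y)"]) simp_all
      then show False using no xy by blast
    qed
    ultimately show ?thesis by blast
  qed
qed

text \<open>Bound a single term of the binomial expansion of \<open>(1 + s / n) ^ n \<le> exp s\<close>.\<close>

lemma binomial_le_exp_mult_power: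
  assumes "0 < s" "s \<le> n"
  shows "real (n choose s) \<le> exp (real s) * (real n / real s) ^ s"
proof -
  define x where "x = real s / real n"
  have x: "x > 0" using assms by (simp add: x_def)
  have "real (n choose s) * x ^ s \<le> (\<Sum>i\<le>n. real (n choose i) * x ^ i)"
    using assms x by (intro member_le_sum) auto
  also have "\<dots> = (x + 1) ^ n" by (simp add: binomial_ring)
  also have "\<dots> \<le> exp x ^ n"
    using x by (intro power_mono) (auto simp: add.commute[of x])
  also have "\<dots> = exp (real s)" using assms by (simp add: x_def flip: exp_of_nat_mult)
  finally have "real (n choose s) \<le> exp (real s) / x ^ s"
    using x by (simp add: pos_le_divide_eq)
  also have "\<dots> = exp (real s) * (real n / real s) ^ s"
    by (simp add: x_def power_divide)
  finally show ?thesis .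
qed

text \<open>About \<open>r\<^sup>2 * s * ln r\<close> edges suffice on \<open>r * s\<close> vertices: there are at most
  \<open>(r * s choose s)\<^sup>2 \<le> exp (2 * s * (1 + ln r))\<close> pairs of \<open>s\<close>-sets, and every greedy step
  shrinks the number of surviving pairs by the factor \<open>1 - 1 / r\<^sup>2\<close>.\<close>

lemma exists_sparse_graph_without_hole_log:
  assumes "finite B" "card B = r * s" "r \<ge> 1" "s \<ge> 1"
    and M: "2 * real s * (1 + ln (real r)) * (real r)\<^sup>2 < real M"
  shows "\<exists>H. simple_graph B H \<and> card H \<le> M \<and> \<not> has_bipartite_hole B H s s"
proof (rule exists_sparse_graph_without_hole[OF \<open>finite B\<close>])
  have rs: "real (card B) / real s = real r" "real s / real (card B) = 1 / real r"
    using assms by (simp_all add: field_simps)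
  define y where "y = 1 / (real r)\<^sup>2"
  have y: "0 \<le> 1 - y" using assms(3) by (simp add: y_def divide_le_eq)
  have "real (card B choose s) \<le> exp (real s) * real r ^ s"
    using binomial_le_exp_mult_power[of s "card B"] assms(2-4) by (simp add: rs)
  also have "\<dots> = exp (real s * (1 + ln (real r)))"
    using assms(3) by (simp add: ring_distribs exp_add exp_of_nat_mult)
  finally have "real (card B choose s) ^ 2 \<le> exp (real s * (1 + ln (real r))) ^ 2"
    by (rule power_mono) simp
  also have "\<dots> = exp (2 * real s * (1 + ln (real r)))"
    by (simp add: mult.assoc flip: exp_of_nat_mult)
  finally have c: "real (card B choose s) ^ 2 \<le> exp (2 * real s * (1 + ln (real r)))" .
  have "(1 - y) ^ M \<le> exp (- y) ^ M"
    using y exp_ge_add_one_self[of "- y"] by (intro power_mono) auto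
  also have "\<dots> = exp (- (real M * y))" by (simp flip: exp_of_nat_mult)
  finally have "real (card B choose s) ^ 2 * (1 - y) ^ M
      \<le> exp (2 * real s * (1 + ln (real r))) * exp (- (real M * y))"
    using c y by (intro mult_mono) auto
  also have "\<dots> = exp (2 * real s * (1 + ln (real r)) - real M * y)"
    by (simp add: exp_diff exp_minus divide_inverse)
  also have "\<dots> < 1"
    using M assms(3) by (simp add: y_def field_simps)
  finally show "real (card B choose s) ^ 2 * (1 - (real s / real (card B))\<^sup>2) ^ M < 1"
    by (simp add: rs y_def power_divide)
qed

section \<open>Joining a clique to a sparse graph\<close>

definition clique_join :: "nat \<Rightarrow> nat \<Rightarrow> nat set set \<Rightarrow> nat set set" where
  "clique_join m n H = H \<union> {e. e \<subseteq> {..<m + n} \<and> card e = 2 \<and> e \<inter> {..<m} \<noteq> {}}"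

lemma simple_graph_clique_join:
  assumes "simple_graph {m..<m + n} H"
  shows "simple_graph {..<m + n} (clique_join m n H)"
  using assms unfolding simple_graph_def clique_join_def by fastforce

lemma clique_join_edge:
  assumes "x < m" "y < m + n" "x \<noteq> y"
  shows "{x, y} \<in> clique_join m n H"
  using assms by (auto simp: clique_join_def)

text \<open>A vertex of the clique is adjacent to all other vertices, so no hole contains one.\<close>

lemma no_hole_clique_join:
  assumes "\<not> has_bipartite_hole {m..<m + n} H s t" "s \<ge> 1" "t \<ge> 1"
  shows "\<not> has_bipartite_hole {..<m + n} (clique_join m n H) s t"
proof
  assume "has_bipartite_hole {..<m + n} (clique_join m n H) s t"
  then obtain S T where ST: "S \<subseteq> {..<m + n}" "T \<subseteq> {..<m + n}" "S \<inter> T = {}" "card S = s" "card T = t"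
    and no: "\<forall>x\<in>S. \<forall>y\<in>T. {x, y} \<notin> clique_join m n H"
    unfolding has_bipartite_hole_def by (elim exE conjE)
  have "S \<noteq> {}" "T \<noteq> {}" using ST assms by auto
  have "\<not> x < m" if x: "x \<in> S" for x
  proof
    assume "x < m"
    obtain y where "y \<in> T" using \<open>T \<noteq> {}\<close> by blast
    then show False
      using clique_join_edge[OF \<open>x < m\<close>, of y n H] ST no x by blast
  qed
  then have S: "S \<subseteq> {m..<m + n}" using ST by (auto simp: not_less)
  have "\<not> y < m" if y: "y \<in> T" for y
  proof
    assume "y < m"
    obtain x where "x \<in> S" using \<open>S \<noteq> {}\<close> by blast
    then show False
      using clique_join_edge[OF \<open>y < m\<close>, of x n H] ST no y by (metis disjoint_iff insert_commute lessThan_iff subsetD)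
  qed
  then have T: "T \<subseteq> {m..<m + n}" using ST by (auto simp: not_less)
  have "has_bipartite_hole {m..<m + n} H s t"
    using S T ST no by (intro has_bipartite_holeI[of S _ T]) (auto simp: clique_join_def)
  then show False using assms(1) by blast
qed

lemma min_degree_clique_join:
  assumes "simple_graph {m..<m + n} H" "n \<ge> 1"
  shows "min_degree {..<m + n} (clique_join m n H) \<ge> m"
proof -
  note G = simple_graph_clique_join[OF assms(1)]
  have "m \<le> degree (clique_join m n H) v" if v: "v < m + n" for v
  proof -
    have "\<exists>W. W \<subseteq> neighbours (clique_join m n H) v \<and> card W = m"
    proof (cases "v < m")
      case True
      have "{..<m + 1} - {v} \<subseteq> neighbours (clique_join m n H) v"
        using True assms(2) by (auto simp: neighbours_def intro!: clique_join_edge)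
      moreover have "card ({..<m + 1} - {v}) = m" using True by simp
      ultimately show ?thesis by blast
    next
      case False
      have "{..<m} \<subseteq> neighbours (clique_join m n H) v"
        using False v clique_join_edge[of _ m v n H] by (auto simp: neighbours_def insert_commute)
      then show ?thesis by (metis card_lessThan)
    qed
    then show ?thesis
      using card_mono[OF finite_neighbours[OF G]] degree_eq_card_neighbours[OF G] by metis
  qed
  then show ?thesis
    using assms(2) unfolding min_degree_def by (intro Min.boundedI) auto
qed

text \<open>At most \<open>2 * m\<close> of the \<open>m + n\<close> edges of the cycle touch the clique.\<close>

lemma hamilton_cycle_clique_join:
  assumes "hamilton_cycle {..<m + n} (clique_join m n H) xs" and "finite H"
  shows "n \<le> m + card (cycle_edges xs \<inter> H)"
proof -
  have xs: "length xs \<ge> 3" "distinct xs" "set xs = {..<m + n}" "cycle_edges xs \<subseteq> clique_join m n H"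
    using assms(1) by (auto simp: hamilton_cycle_def)
  have fin: "finite (cycle_edges xs)" by (simp add: cycle_edges_def)
  have "m + n = card (cycle_edges xs)"
    using xs by (metis card_cycle_edges card_lessThan distinct_card)
  also have "\<dots> \<le> card ((cycle_edges xs \<inter> H) \<union> (\<Union>v\<in>{..<m}. {e \<in> cycle_edges xs. v \<in> e}))"
    using xs(4) fin by (intro card_mono) (auto simp: clique_join_def)
  also have "\<dots> \<le> card (cycle_edges xs \<inter> H) + card (\<Union>v\<in>{..<m}. {e \<in> cycle_edges xs. v \<in> e})"
    by (rule card_Un_le)
  also have "card (\<Union>v\<in>{..<m}. {e \<in> cycle_edges xs. v \<in> e}) \<le> (\<Sum>v<m. degree (cycle_edges xs) v)"
    unfolding degree_def by (rule card_UN_le) simp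
  also have "\<dots> \<le> (\<Sum>v<m. 2)" by (intro sum_mono degree_cycle_edges xs)
  finally show ?thesis by simp
qed

text \<open>The obstruction behind all lower bounds: each Hamilton cycle uses at least \<open>n - m\<close> edges of
  \<open>H\<close>, so \<open>k\<close> disjoint ones need \<open>k * (n - m)\<close> edges, although the minimum degree is at
  least \<open>m\<close>.\<close>

lemma forces_hamilton_cycles_clique_join:
  assumes H: "simple_graph {m..<m + n} H" and cH: "card H + k * m < k * n"
    and hole: "\<not> has_bipartite_hole {m..<m + n} H s t" and st: "s \<ge> 1" "t \<ge> 1" "s + t \<le> Suc a"
    and "m + n \<ge> 3" and forces: "forces_hamilton_cycles a k d"
  shows "m < d"
proof (rule ccontr)
  assume "\<not> m < d"
  have "n \<ge> 1" using cH by (cases n) auto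
  have "bipartite_hole_number {..<m + n} (clique_join m n H) \<le> s + t - 1"
    unfolding bipartite_hole_number_def
    by (rule Least_le) (use no_hole_clique_join[OF hole] st in blast)
  also have "\<dots> \<le> a" using st by simp
  finally have "has_disjoint_hamilton_cycles {..<m + n} (clique_join m n H) k"
    using forces simple_graph_clique_join[OF H] \<open>m + n \<ge> 3\<close> min_degree_clique_join[OF H \<open>n \<ge> 1\<close>] \<open>\<not> m < d\<close>
    unfolding forces_hamilton_cycles_def by simp
  then obtain C where C: "\<And>i. i < k \<Longrightarrow> hamilton_cycle {..<m + n} (clique_join m n H) (C i)"
    and disj: "disjoint_family_on (\<lambda>i. cycle_edges (C i)) {..<k}"
    unfolding has_disjoint_hamilton_cycles_def by blast
  have finH: "finite H" by (rule finite_edges[OF H])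
  have "k * n = (\<Sum>i<k. n)" by simp
  also have "\<dots> \<le> (\<Sum>i<k. m + card (cycle_edges (C i) \<inter> H))"
    by (rule sum_mono) (use hamilton_cycle_clique_join[OF C finH] in auto)
  also have "\<dots> = k * m + (\<Sum>i<k. card (cycle_edges (C i) \<inter> H))"
    by (simp add: sum.distrib)
  also have "(\<Sum>i<k. card (cycle_edges (C i) \<inter> H)) = card (\<Union>i<k. cycle_edges (C i) \<inter> H)"
    using disj finH by (intro card_UN_disjoint[symmetric]) (auto simp: disjoint_family_on_def)
  also have "\<dots> \<le> card H" using finH by (intro card_mono) auto
  finally show False using cH by simp
qed

section \<open>Order of magnitude of the threshold\<close>

lemma one_le_ln_add_2:
  assumes "k \<ge> (2::nat)"
  shows "1 \<le> ln (real k + 2)"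
proof -
  have "exp 1 \<le> real k + 2" using exp_le assms by linarith
  then show ?thesis using assms by (subst ln_ge_iff) auto
qed

text \<open>With \<open>l\<close> about \<open>ln (k + 2) / 2\<close>, the heavy term \<open>6 * k * a div Suc l\<close> gains the
  logarithm, and the light term \<open>2 ^ l * a\<close> is at most \<open>a * sqrt (k + 2)\<close>, which is of smaller
  order. That some minimum degree suffices at all is needed for the lower bound too, since the
  least element of an empty set of numbers carries no information.\<close>

lemma hamilton_threshold_le:
  assumes "k \<ge> 2"
  shows "forces_hamilton_cycles a k (hamilton_threshold a k)"
    and "real (hamilton_threshold a k) \<le> 16 * (real a + real k + real a * real k / ln (real k + 2))"
proof -
  define L where "L = ln (real k + 2)"
  have L: "L \<ge> 1" using one_le_ln_add_2[OF assms] by (simp add: L_def)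
  define l where "l = nat \<lfloor>L / 2\<rfloor>"
  have l: "real l \<le> L / 2" "L / 2 \<le> real (Suc l)"
    using L by (simp_all add: l_def) linarith+
  define d where "d = 8 * k + 3 * a + 6 * k * a div Suc l + 2 ^ l * a"
  have forces: "forces_hamilton_cycles a k d"
    by (intro forces_hamilton_cyclesI[of k a l]) (simp add: d_def)
  then show "forces_hamilton_cycles a k (hamilton_threshold a k)"
    unfolding hamilton_threshold_def by (rule LeastI)
  have "hamilton_threshold a k \<le> d"
    unfolding hamilton_threshold_def using forces by (rule Least_le)
  then have "real (hamilton_threshold a k) \<le> real d" by simp
  also have "\<dots> \<le> 8 * real k + 3 * real a + 12 * (real a * real k / L) + 4 * (real a * real k / L)"
  proof -
    have "real (6 * k * a div Suc l) \<le> real (6 * k * a) / real (Suc l)"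
      by (rule of_nat_div_le_of_nat)
    also have "\<dots> \<le> real (6 * k * a) / (L / 2)"
      using L l by (intro divide_left_mono) auto
    finally have 1: "real (6 * k * a div Suc l) \<le> 12 * (real a * real k / L)"
      by (simp add: mult_ac)
    \<comment> \<open>Light term: \<open>2 ^ l \<le> exp (L / 2) = sqrt (k + 2)\<close>, and \<open>L / 2 \<le> exp (L / 2)\<close>.\<close>
    have "(2::real) ^ l \<le> exp 1 ^ l"
      using exp_ge_add_one_self[of "1::real"] by (intro power_mono) auto
    also have "\<dots> = exp (real l)" by (simp flip: exp_of_nat_mult)
    also have "\<dots> \<le> exp (L / 2)" using l by simp
    finally have 2: "(2::real) ^ l \<le> exp (L / 2)" .
    have "L / 2 \<le> exp (L / 2)" using exp_ge_add_one_self[of "L / 2"] by linarith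
    then have "exp (L / 2) * (L / 2) \<le> exp (L / 2) * exp (L / 2)" by simp
    also have "\<dots> = exp L" by (simp flip: exp_add)
    also have "\<dots> = real k + 2" by (simp add: L_def)
    also have "\<dots> \<le> 2 * real k" using assms by simp
    finally have "exp (L / 2) \<le> 4 * real k / L" using L by (simp add: field_simps)
    then have "2 ^ l * real a \<le> 4 * real k / L * real a"
      using 2 by (intro mult_right_mono) auto
    then have "2 ^ l * real a \<le> 4 * (real a * real k / L)" by (simp add: mult_ac)
    moreover have "real d = 8 * real k + 3 * real a + real (6 * k * a div Suc l) + 2 ^ l * real a"
      by (simp add: d_def)
    ultimately show ?thesis using 1 by linarith
  qed
  also have "\<dots> \<le> 16 * (real a + real k + real a * real k / L)"
    using L by simp
  finally show "real (hamilton_threshold a k) \<le> 16 * (real a + real k + real a * real k / ln (real k + 2))"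
    by (simp add: L_def)
qed

text \<open>A complete graph on \<open>k + k div 2\<close> vertices, seen as a clique join, has too few edges for
  \<open>k\<close> Hamilton cycles.\<close>

lemma forces_hamilton_cycles_ge_k:
  assumes "k \<ge> 2" "a \<ge> 1" "forces_hamilton_cycles a k d"
  shows "k < 2 * d"
proof -
  define m where "m = k div 2"
  define H where "H = {e. e \<subseteq> {m..<m + k} \<and> card e = 2}"
  have "m < d"
  proof (rule forces_hamilton_cycles_clique_join[OF _ _ _ _ _ _ _ assms(3)])
    show "simple_graph {m..<m + k} H" by (simp add: simple_graph_def H_def)
    have "card H = k * (k - 1) div 2"
      using n_subsets[of "{m..<m + k}" 2] by (simp add: H_def choose_two)
    then have "2 * card H \<le> k * (k - 1)" by simp
    also have "\<dots> < k * (2 * (k - m))" using assms(1) by (intro mult_strict_left_mono) (auto simp: m_def)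
    finally have "card H < k * (k - m)" by simp
    then show "card H + k * m < k * k" by (simp add: m_def diff_mult_distrib2 less_diff_conv)
    show "\<not> has_bipartite_hole {m..<m + k} H 1 1"
    proof
      assume "has_bipartite_hole {m..<m + k} H 1 1"
      then obtain S T where ST: "S \<subseteq> {m..<m + k}" "T \<subseteq> {m..<m + k}" "S \<inter> T = {}" "card S = 1" "card T = 1"
        and no: "\<forall>x\<in>S. \<forall>y\<in>T. {x, y} \<notin> H"
        unfolding has_bipartite_hole_def by (elim exE conjE)
      obtain x y where "S = {x}" "T = {y}" using ST(4,5) by (auto simp: card_1_singleton_iff)
      then show False using ST no by (auto simp: H_def)
    qed
  qed (use assms in \<open>auto simp: m_def\<close>)
  then show ?thesis by (simp add: m_def)
qed

text \<open>An independent set of size \<open>a\<close> joined to a clique of size \<open>a - 1\<close> has no Hamilton cycle.\<close>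

lemma forces_hamilton_cycles_ge_a:
  assumes "k \<ge> 1" "a \<ge> 2" "forces_hamilton_cycles a k d"
  shows "a \<le> d"
proof -
  define m where "m = a - 1"
  have a: "a = Suc m" using assms(2) by (simp add: m_def)
  have "m < d"
  proof (rule forces_hamilton_cycles_clique_join[OF _ _ _ _ _ _ _ assms(3)])
    show "simple_graph {m..<m + a} {}" by (simp add: simple_graph_def)
    show "\<not> has_bipartite_hole {m..<m + a} {} 1 a"
    proof
      assume "has_bipartite_hole {m..<m + a} {} 1 a"
      then obtain S T where ST: "S \<subseteq> {m..<m + a}" "T \<subseteq> {m..<m + a}" "S \<inter> T = {}" "card S = 1" "card T = a"
        unfolding has_bipartite_hole_def by (elim exE conjE)
      then have "T = {m..<m + a}" by (intro card_subset_eq) auto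
      then have "S = {}" using ST by blast
      then show False using ST by simp
    qed
  qed (use assms a in auto)
  then show ?thesis using a by simp
qed

text \<open>Join a clique on \<open>q * s\<close> vertices to a sparse graph without \<open>(s, s)\<close>-holes on
  \<open>2 * q * s\<close> vertices, where \<open>s = a div 2\<close>. That graph can be chosen with roughly
  \<open>q\<^sup>2 * s * ln q\<close> edges, which is less than \<open>k * q * s\<close> when \<open>q\<close> is a small multiple of
  \<open>k / ln (k + 2)\<close>. If that multiple is below 1, the bound \<open>a \<le> d\<close> is already strong enough.\<close>

lemma forces_hamilton_cycles_ge_log:
  assumes "k \<ge> 2" "a \<ge> 2" "forces_hamilton_cycles a k d"
  shows "real a * real k / ln (real k + 2) \<le> 192 * real d"
proof -
  define L where "L = ln (real k + 2)"
  have L: "L \<ge> 1" using one_le_ln_add_2[OF assms(1)] by (simp add: L_def)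
  \<comment> \<open>The constant 32 makes the edge budget \<open>k * q * s\<close> twice what the sparse graph needs.\<close>
  define x where "x = real k / (32 * L)"
  have akx: "real a * real k / L = 32 * (real a * x)" using L by (simp add: x_def)
  have "real a * x \<le> 6 * real d"
  proof (cases "x < 1")
    case True
    have "real a * x \<le> real a" using True by (simp add: mult_left_le)
    also have "\<dots> \<le> real d" using forces_hamilton_cycles_ge_a[OF _ assms(2,3)] assms(1) by simp
    finally show ?thesis by simp
  next
    case False
    define q where "q = nat \<lfloor>x\<rfloor>"
    have q: "q \<ge> 1" "real q \<le> x" "x < real q + 1"
      using False by (simp_all add: q_def le_nat_floor)
    define s where "s = a div 2"
    have s: "s \<ge> 1" "2 * s \<le> a" "a \<le> 3 * s" using assms(2) by (auto simp: s_def)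
    have qk: "32 * real q * L \<le> real k" using q(2) L by (simp add: x_def field_simps)
    have "32 * real q * 1 \<le> 32 * real q * L" using L by (intro mult_left_mono) auto
    then have k32: "32 * real q \<le> real k" using qk by linarith
    then have k: "k \<ge> 32" using q(1) by linarith
    have "ln (real (2 * q)) \<le> L"
      unfolding L_def using k32 q(1) by (intro ln_mono) auto
    then have "2 * real s * (1 + ln (real (2 * q))) * (real (2 * q))\<^sup>2
        \<le> 2 * real s * (2 * L) * (real (2 * q))\<^sup>2"
      using L by (intro mult_right_mono mult_left_mono) auto
    also have "\<dots> = real q * real s / 2 * (32 * real q * L)"
      by (simp add: power2_eq_square)
    also have "\<dots> \<le> real q * real s / 2 * real k"
      using qk by (intro mult_left_mono) auto
    also have "\<dots> < real (k * q * s - 1)"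
    proof -
      have "32 * 1 * 1 \<le> k * q * s" using k q(1) s(1) by (intro mult_mono) auto
      then have "real (k * q * s - 1) = real (k * q * s) - 1" "32 \<le> real (k * q * s)" by linarith+
      moreover have "real q * real s / 2 * real k = real (k * q * s) / 2" by simp
      ultimately show ?thesis by linarith
    qed
    finally have M: "2 * real s * (1 + ln (real (2 * q))) * (real (2 * q))\<^sup>2 < real (k * q * s - 1)" .
    define m where "m = q * s"
    have "m \<ge> 1" using q s by (simp add: m_def Suc_le_eq)
    obtain H where H: "simple_graph {m..<m + 2 * m} H" "card H \<le> k * q * s - 1"
      "\<not> has_bipartite_hole {m..<m + 2 * m} H s s"
      using exists_sparse_graph_without_hole_log[OF _ _ _ s(1) M, of "{m..<m + 2 * m}"] q(1)
      by (auto simp: m_def)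
    have "k * q * s \<ge> 1" using k q(1) s(1) by (simp add: Suc_le_eq)
    then have "card H < k * m" using H(2) unfolding m_def mult.assoc by linarith
    then have "m < d"
      using forces_hamilton_cycles_clique_join[OF H(1) _ H(3) s(1) s(1) _ _ assms(3)] s \<open>m \<ge> 1\<close>
      by simp
    have "real a * x \<le> real (3 * s) * (2 * real q)"
      using s(3) q False by (intro mult_mono) linarith+
    also have "\<dots> = 6 * real m" by (simp add: m_def)
    also have "\<dots> \<le> 6 * real d" using \<open>m < d\<close> by simp
    finally show ?thesis .
  qed
  then show ?thesis using akx unfolding L_def by linarith
qed

theorem theorem1p3:
  shows "\<exists>c C :: real. c > 0 \<and> C > 0 \<and>
    (\<forall>a k :: nat. a \<ge> 2 \<longrightarrow> k \<ge> 2 \<longrightarrow>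
       c * (real a + real k + real a * real k / ln (real k + 2)) \<le> real (hamilton_threshold a k) \<and>
       real (hamilton_threshold a k) \<le> C * (real a + real k + real a * real k / ln (real k + 2)))"
proof (rule exI[of _ "1/195"], rule exI[of _ 16], intro conjI allI impI)
  fix a k :: nat assume "a \<ge> 2" "k \<ge> 2"
  note forces = hamilton_threshold_le(1)[OF \<open>k \<ge> 2\<close>, of a]
  have "k < 2 * hamilton_threshold a k" "a \<le> hamilton_threshold a k"
    "real a * real k / ln (real k + 2) \<le> 192 * real (hamilton_threshold a k)"
    using forces_hamilton_cycles_ge_k[OF \<open>k \<ge> 2\<close> _ forces]
      forces_hamilton_cycles_ge_a[OF _ \<open>a \<ge> 2\<close> forces]
      forces_hamilton_cycles_ge_log[OF \<open>k \<ge> 2\<close> \<open>a \<ge> 2\<close> forces] \<open>a \<ge> 2\<close> \<open>k \<ge> 2\<close> by simp_all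
  then show "1/195 * (real a + real k + real a * real k / ln (real k + 2)) \<le> real (hamilton_threshold a k)"
    by simp
  show "real (hamilton_threshold a k) \<le> 16 * (real a + real k + real a * real k / ln (real k + 2))"
    by (rule hamilton_threshold_le(2)[OF \<open>k \<ge> 2\<close>])
qed simp_all

end
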